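(* Let $\Sigma=\{\sigma_1,\ldots,\sigma_n\}$ be a collection of maps $\{1,\ldots,N\}\to\{1,\ldots,N\}$, not necessarily forming a semigroup, and let $\gamma_f$ be a coupled cell network vector field subject to $\Sigma$. Then a local normal form $\gamma_{\overline f}$ of $\gamma_f$ (which is a coupled cell network vector field subject to the semigroup $\Sigma'$ generated by $\Sigma$) has the same network symmetries and the same synchrony spaces as $\gamma_f$.
   Context: $V$ is a finite dimensional real vector space. For a collection $\Sigma=\{\sigma_1,\ldots,\sigma_n\}$ of $n$ distinct maps on $\{1,\ldots,N\}$ and $f\in C^\infty(V^n,V)$, the network vector field $\gamma_f:V^N\to V^N$ subject to $\Sigma$ is $(\gamma_f)_i(x)=f(x_{\sigma_1(i)},\ldots,x_{\sigma_n(i)})$. The semigroup $\Sigma'=\{\sigma_1,\ldots,\sigma_{n'}\}\supset\Sigma$ generated by $\Sigma$ is the smallest collection of maps on $\{1,\ldots,N\}$ containing $\Sigma$ and closed under composition. With $f'(X_1,\ldots,X_{n'}):=f(X_1,\ldots,X_n)$, $\gamma_f$ equals $\gamma_{f'}$, a network vector field subject to $\Sigma'$. Local normal form: assume $f(0)=0$ and Taylor expand $f'=f_0+f_1+\ldots$ with $f_k\in P^k$, the space of homogeneous polynomial maps $V^{n'}\to V$ of degree $k+1$. For the semigroup $\Sigma'$ let $\widetilde\sigma_j$ be given by $\sigma_{\widetilde\sigma_j(k)}=\sigma_j\circ\sigma_k$, $A_{\sigma_j}(X_1,\ldots,X_{n'})=(X_{\widetilde\sigma_1(j)},\ldots,X_{\widetilde\sigma_{n'}(j)})$,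 and $\mathrm{ad}^{\Sigma'}_{f_0}(g)=\sum_{j=1}^{n'}D_jf_0\cdot(g\circ A_{\sigma_j})-D_jg\cdot(f_0\circ A_{\sigma_j})$. Given $r\ge1$ and subspaces $N^k\subset P^k$ with $N^k\oplus\operatorname{im}\mathrm{ad}^{\Sigma'}_{f_0}|_{P^k}=P^k$ for $1\le k\le r$, a local normal form of $\gamma_f$ is a network vector field $\gamma_{\overline f}$ subject to $\Sigma'$, $\overline f\in C^\infty(V^{n'},V)$, $\overline f=f_0+\overline f_1+\ldots$ with $\overline f_k\in N^k$ for $1\le k\le r$, to which $\gamma_f$ is conjugated by an analytic diffeomorphism between open neighborhoods of $0$ in $V^N$. The network symmetries of a network vector field subject to a collection of maps are the permutations $p$ of $\{1,\ldots,N\}$ with $p\circ\sigma=\sigma\circ p$ for all $\sigma$ in that collection. For a partition $P$ of $\{1,\ldots,N\}$, $\mathrm{Syn}_P=\{x\in V^N\mid x_{i_1}=x_{i_2}$ when $i_1,i_2$ are in the same element of $P\}$. The synchrony spaces of a network vector field subject to a collection of maps are the (robust) synchrony spaces of the collection: those $\mathrm{Syn}_P$ that are invariant under the dynamics of all network vector fields (for all smooth response functions) subject to that collection. Here the collection is $\Sigma$ for $\gamma_f$ and $\Sigma'$ for $\gamma_{\overline f}$. *)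

theory Defs
  imports
    "HOL-Analysis.Analysis"
    "HOL-Library.Disjoint_Sets"
    "HOL-Library.Function_Algebras"
begin

section \<open>Smooth and real analytic maps, Taylor expansion\<close>

text \<open>
  Throughout, maps are total functions and \<open>S\<close> is meant to be an open set. A map is of class
  \<open>C^(k+1)\<close> iff it is differentiable and all its directional derivatives are of class \<open>C^k\<close>;
  in finite dimension this is the usual notion.
\<close>

primrec C_k_on :: "nat \<Rightarrow> 'a::real_normed_vector set \<Rightarrow> ('a \<Rightarrow> 'b::real_normed_vector) \<Rightarrow> bool" where
  "C_k_on 0 S f \<longleftrightarrow> continuous_on S f"
| "C_k_on (Suc k) S f \<longleftrightarrow> (\<forall>x\<in>S. f differentiable (at x)) \<and>
     (\<forall>v. C_k_on k S (\<lambda>x. frechet_derivative f (at x) v))"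

definition smooth_on :: "'a::real_normed_vector set \<Rightarrow> ('a \<Rightarrow> 'b::real_normed_vector) \<Rightarrow> bool" where
  "smooth_on S f \<longleftrightarrow> (\<forall>k. C_k_on k S f)"

text \<open>The homogeneous term \<open>D^d f(a)(h,\<dots>,h) / d!\<close> of degree \<open>d\<close> of the Taylor series of \<open>f\<close> at \<open>a\<close>.\<close>

definition taylor_term ::
  "('a::real_normed_vector \<Rightarrow> 'b::real_normed_vector) \<Rightarrow> 'a \<Rightarrow> nat \<Rightarrow> 'a \<Rightarrow> 'b" where
  "taylor_term f a d h =
     ((\<lambda>g x. frechet_derivative g (at x) h) ^^ d) f a /\<^sub>R fact d"

definition real_analytic_on ::
  "'a::real_normed_vector set \<Rightarrow> ('a \<Rightarrow> 'b::real_normed_vector) \<Rightarrow> bool" where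
  "real_analytic_on S f \<longleftrightarrow> smooth_on S f \<and>
     (\<forall>a\<in>S. \<exists>e>0. \<forall>x\<in>ball a e. (\<lambda>d. taylor_term f a d (x - a)) sums f x)"

definition analytic_diffeomorphism ::
  "'a::real_normed_vector set \<Rightarrow> 'b::real_normed_vector set \<Rightarrow> ('a \<Rightarrow> 'b) \<Rightarrow> ('b \<Rightarrow> 'a) \<Rightarrow> bool" where
  "analytic_diffeomorphism U W \<Phi> \<Psi> \<longleftrightarrow> open U \<and> open W \<and> \<Phi> ` U = W \<and> \<Psi> ` W = U \<and>
     (\<forall>x\<in>U. \<Psi> (\<Phi> x) = x) \<and> (\<forall>y\<in>W. \<Phi> (\<Psi> y) = y) \<and>
     real_analytic_on U \<Phi> \<and> real_analytic_on W \<Psi>"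

section \<open>Coupled cell networks\<close>

text \<open>
  Cells are the elements of a finite type \<open>'c\<close>. A collection of maps on the cells is an indexed
  family \<open>\<sigma> :: 'i \<Rightarrow> 'c \<Rightarrow> 'c\<close> over a finite type; the maps of the collection are distinct iff
  \<open>\<sigma>\<close> is injective.
\<close>

definition network_vf :: "('i::finite \<Rightarrow> 'c \<Rightarrow> 'c) \<Rightarrow> ('v ^ 'i \<Rightarrow> 'v) \<Rightarrow> 'v ^ 'c::finite \<Rightarrow> 'v ^ 'c" where
  "network_vf \<sigma> f x = (\<chi> i. f (\<chi> j. x $ \<sigma> j i))"

inductive_set generated_semigroup :: "('c \<Rightarrow> 'c) set \<Rightarrow> ('c \<Rightarrow> 'c) set" for S where
  incl: "s \<in> S \<Longrightarrow> s \<in> generated_semigroup S"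
| comp: "s \<in> generated_semigroup S \<Longrightarrow> t \<in> generated_semigroup S \<Longrightarrow>
    s \<circ> t \<in> generated_semigroup S"

text \<open>
  If every map of the family \<open>\<sigma>\<close> occurs in the injective family \<open>\<sigma>'\<close>, then \<open>extend_response \<sigma> \<sigma>' f\<close>
  is \<open>f\<close> regarded as a response function for \<open>\<sigma>'\<close> that depends only on the inputs from \<open>\<sigma>\<close>.
\<close>

definition extend_response ::
  "('n::finite \<Rightarrow> 'c \<Rightarrow> 'c) \<Rightarrow> ('m::finite \<Rightarrow> 'c \<Rightarrow> 'c) \<Rightarrow> ('v ^ 'n \<Rightarrow> 'v) \<Rightarrow> 'v ^ 'm \<Rightarrow> 'v" where
  "extend_response \<sigma> \<sigma>' f X = f (\<chi> j. X $ (THE l. \<sigma>' l = \<sigma> j))"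

lemma network_vf_extend_response:
  assumes "inj \<sigma>'" "range \<sigma> \<subseteq> range \<sigma>'"
  shows "network_vf \<sigma>' (extend_response \<sigma> \<sigma>' f) = network_vf \<sigma> f"
proof -
  have "\<sigma>' (THE l. \<sigma>' l = \<sigma> j) = \<sigma> j" for j
    by (rule theI') (use assms in \<open>metis UNIV_I image_subset_iff inj_eq rangeE\<close>)
  then show ?thesis
    by (simp add: fun_eq_iff network_vf_def extend_response_def)
qed

definition network_symmetries :: "('i \<Rightarrow> 'c \<Rightarrow> 'c) \<Rightarrow> ('c \<Rightarrow> 'c) set" where
  "network_symmetries \<sigma> = {p. bij p \<and> (\<forall>j. p \<circ> \<sigma> j = \<sigma> j \<circ> p)}"

definition Syn :: "'c set set \<Rightarrow> ('v ^ 'c::finite) set" where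
  "Syn P = {x. \<forall>B\<in>P. \<forall>i\<in>B. \<forall>k\<in>B. x $ i = x $ k}"

text \<open>Every solution of \<open>x' = \<gamma>(x)\<close>, on any time interval, that meets \<open>S\<close> stays in \<open>S\<close>.\<close>

definition dynamically_invariant :: "('a::real_normed_vector \<Rightarrow> 'a) \<Rightarrow> 'a set \<Rightarrow> bool" where
  "dynamically_invariant \<gamma> S \<longleftrightarrow>
     (\<forall>I x. is_interval (I::real set) \<longrightarrow>
        (\<forall>t\<in>I. (x has_vector_derivative \<gamma> (x t)) (at t within I)) \<longrightarrow>
        (\<forall>t\<^sub>0\<in>I. x t\<^sub>0 \<in> S \<longrightarrow> (\<forall>t\<in>I. x t \<in> S)))"

definition synchrony_spaces ::
  "('i::finite \<Rightarrow> 'c \<Rightarrow> 'c) \<Rightarrow> ('v::euclidean_space ^ 'c::finite) set set" where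
  "synchrony_spaces \<sigma> = {Syn P | P. partition_on UNIV P \<and>
     (\<forall>g :: 'v ^ 'i \<Rightarrow> 'v. smooth_on UNIV g \<longrightarrow>
        dynamically_invariant (network_vf \<sigma> g) (Syn P))}"

section \<open>Local normal forms\<close>

interpretation fun_vs: vector_space "\<lambda>(c::real) (g :: 'a \<Rightarrow> 'b::real_vector) x. c *\<^sub>R g x"
  by unfold_locales (auto simp: fun_eq_iff algebra_simps)

text \<open>The space \<open>P^k\<close>; note that the degree is \<open>k + 1\<close>.\<close>

definition homogeneous_poly :: "nat \<Rightarrow> ('a::real_normed_vector \<Rightarrow> 'b::real_normed_vector) set" where
  "homogeneous_poly k =
     {g. polynomial_function g \<and> (\<forall>c x. g (c *\<^sub>R x) = c ^ (k + 1) *\<^sub>R g x)}"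

text \<open>
  For an injective family \<open>\<sigma>\<close> closed under composition, \<open>prod_index \<sigma> j k\<close> is the index
  \<open>\<sigma>~\<^sub>j(k)\<close> of the composite of \<open>\<sigma> j\<close> and \<open>\<sigma> k\<close>.
\<close>

definition prod_index :: "('i \<Rightarrow> 'c \<Rightarrow> 'c) \<Rightarrow> 'i \<Rightarrow> 'i \<Rightarrow> 'i" where
  "prod_index \<sigma> j k = (THE l. \<sigma> l = \<sigma> j \<circ> \<sigma> k)"

definition A_map :: "('i::finite \<Rightarrow> 'c \<Rightarrow> 'c) \<Rightarrow> 'i \<Rightarrow> 'v ^ 'i \<Rightarrow> 'v ^ 'i" where
  "A_map \<sigma> j X = (\<chi> k. X $ prod_index \<sigma> k j)"

definition partial_deriv ::
  "'i::finite \<Rightarrow> ('v::euclidean_space ^ 'i \<Rightarrow> 'v) \<Rightarrow> 'v ^ 'i \<Rightarrow> 'v \<Rightarrow> 'v" where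
  "partial_deriv j g X v = frechet_derivative g (at X) (axis j v)"

definition ad_network ::
  "('i::finite \<Rightarrow> 'c \<Rightarrow> 'c) \<Rightarrow> ('v::euclidean_space ^ 'i \<Rightarrow> 'v) \<Rightarrow> ('v ^ 'i \<Rightarrow> 'v) \<Rightarrow> 'v ^ 'i \<Rightarrow> 'v" where
  "ad_network \<sigma> f\<^sub>0 g X =
     (\<Sum>j\<in>UNIV. partial_deriv j f\<^sub>0 X (g (A_map \<sigma> j X)) - partial_deriv j g X (f\<^sub>0 (A_map \<sigma> j X)))"

definition is_complement ::
  "('a \<Rightarrow> 'b::real_vector) set \<Rightarrow> ('a \<Rightarrow> 'b) set \<Rightarrow> ('a \<Rightarrow> 'b) set \<Rightarrow> bool" where
  "is_complement N M P \<longleftrightarrow> fun_vs.subspace N \<and> N \<inter> M = {0} \<and> {g + h | g h. g \<in> N \<and> h \<in> M} = P"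

text \<open>
  The summand \<open>f\<^sub>k\<close> of an expansion \<open>f = f\<^sub>0 + f\<^sub>1 + \<dots>\<close> is \<open>taylor_term f 0 (k + 1)\<close>.
\<close>

definition normal_form_spaces ::
  "('m::finite \<Rightarrow> 'c \<Rightarrow> 'c) \<Rightarrow> ('v::euclidean_space ^ 'm \<Rightarrow> 'v) \<Rightarrow> nat \<Rightarrow>
   (nat \<Rightarrow> ('v ^ 'm \<Rightarrow> 'v) set) \<Rightarrow> bool" where
  "normal_form_spaces \<sigma>' f' r N \<longleftrightarrow> (\<forall>k\<in>{1..r}.
     is_complement (N k) (ad_network \<sigma>' (taylor_term f' 0 1) ` homogeneous_poly k)
       (homogeneous_poly k))"

definition locally_analytically_conjugate ::
  "('a::real_normed_vector \<Rightarrow> 'a) \<Rightarrow> ('a \<Rightarrow> 'a) \<Rightarrow> bool" where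
  "locally_analytically_conjugate \<gamma> \<gamma>' \<longleftrightarrow>
     (\<exists>U W \<Phi> \<Psi>. 0 \<in> U \<and> 0 \<in> W \<and> analytic_diffeomorphism U W \<Phi> \<Psi> \<and>
        (\<forall>x\<in>U. frechet_derivative \<Phi> (at x) (\<gamma> x) = \<gamma>' (\<Phi> x)))"

text \<open>
  Here \<open>f'\<close> is the response function for \<open>\<sigma>'\<close> whose network vector field is put in normal form;
  the first conjunct says that the constant term of \<open>fbar\<close> vanishes.
\<close>

definition local_normal_form ::
  "('m::finite \<Rightarrow> 'c::finite \<Rightarrow> 'c) \<Rightarrow> ('v::euclidean_space ^ 'm \<Rightarrow> 'v) \<Rightarrow> nat \<Rightarrow>
   (nat \<Rightarrow> ('v ^ 'm \<Rightarrow> 'v) set) \<Rightarrow> ('v ^ 'm \<Rightarrow> 'v) \<Rightarrow> bool" where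
  "local_normal_form \<sigma>' f' r N fbar \<longleftrightarrow>
     fbar 0 = 0 \<and> smooth_on UNIV fbar \<and>
     taylor_term fbar 0 1 = taylor_term f' 0 1 \<and>
     (\<forall>k\<in>{1..r}. taylor_term fbar 0 (k + 1) \<in> N k) \<and>
     locally_analytically_conjugate (network_vf \<sigma>' f') (network_vf \<sigma>' fbar)"

end

theory Submission
  imports Defs
begin

text \<open>
  Both sides of each equality are determined by conditions on single maps of the collection that
  pass from two maps to their composite; such a condition holds on a collection iff it holds on the
  semigroup that the collection generates. For the symmetries, the condition is to commute with a
  given permutation.

  For the synchrony spaces, the condition is that a map sends each block of the partition
  \<open>P\<close> into a block. That this combinatorial condition is equivalent to the dynamical definition is
  the substance of the proof (lemma \<open>dynamically_invariant_iff_balanced\<close>).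

  \<^item> If all maps respect the blocks, then every network vector field is tangent to the linear subspace
  \<open>Syn P\<close>. It is also Lipschitz on balls, so the component of a solution transverse to
  \<open>Syn P\<close> satisfies a Gronwall estimate: if it vanishes once, it vanishes always.

  \<^item> Conversely, the response function \<open>X \<mapsto> X\<^sub>j\<close> gives the linear system
  \<open>x\<^sub>i' = x\<^bsub>\<sigma> j i\<^esub>\<close>. It is solved explicitly by a power series from an initial condition that
  is a nonzero vector on one block and \<open>0\<close> on the others. If the solution stays in \<open>Syn P\<close>, so does
  its velocity at time \<open>0\<close>; but this velocity is nonzero exactly at the cells that \<open>\<sigma> j\<close> sends
  into the chosen block, so these cells form a union of blocks.
\<close>

section \<open>Conditions inherited by the generated semigroup\<close>

lemma ball_generated_semigroup_iff:
  assumes "\<And>s t. Q s \<Longrightarrow> Q t \<Longrightarrow> Q (s \<circ> t)"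
  shows "(\<forall>s\<in>generated_semigroup S. Q s) \<longleftrightarrow> (\<forall>s\<in>S. Q s)"
proof
  assume S: "\<forall>s\<in>S. Q s"
  have "Q s" if "s \<in> generated_semigroup S" for s
    using that by induction (use S assms in blast)+
  then show "\<forall>s\<in>generated_semigroup S. Q s" by blast
qed (blast intro: generated_semigroup.incl)

lemma network_symmetries_generated_semigroup:
  assumes "range \<sigma>' = generated_semigroup (range \<sigma>)"
  shows "network_symmetries \<sigma>' = network_symmetries \<sigma>"
proof -
  have "(\<forall>s\<in>range \<sigma>'. p \<circ> s = s \<circ> p) \<longleftrightarrow> (\<forall>s\<in>range \<sigma>. p \<circ> s = s \<circ> p)" for p
    unfolding assms by (rule ball_generated_semigroup_iff) (metis comp_assoc)
  then show ?thesis
    by (simp add: network_symmetries_def)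
qed

text \<open>Partitions satisfying this condition are known as balanced (for the given collection).\<close>

definition balanced :: "('i \<Rightarrow> 'c \<Rightarrow> 'c) \<Rightarrow> 'c set set \<Rightarrow> bool" where
  "balanced \<sigma> P \<longleftrightarrow> (\<forall>s\<in>range \<sigma>. \<forall>B\<in>P. \<exists>B'\<in>P. s ` B \<subseteq> B')"

lemma balanced_generated_semigroup:
  assumes "range \<sigma>' = generated_semigroup (range \<sigma>)"
  shows "balanced \<sigma>' P \<longleftrightarrow> balanced \<sigma> P"
  unfolding balanced_def assms
proof (rule ball_generated_semigroup_iff)
  fix s t
  assume s: "\<forall>B\<in>P. \<exists>B'\<in>P. s ` B \<subseteq> B'" and t: "\<forall>B\<in>P. \<exists>B'\<in>P. t ` B \<subseteq> B'"
  show "\<forall>B\<in>P. \<exists>B'\<in>P. (s \<circ> t) ` B \<subseteq> B'"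
  proof
    fix B assume "B \<in> P"
    then obtain B1 where "B1 \<in> P" "t ` B \<subseteq> B1" using t by blast
    moreover from \<open>B1 \<in> P\<close> obtain B2 where "B2 \<in> P" "s ` B1 \<subseteq> B2" using s by blast
    ultimately show "\<exists>B'\<in>P. (s \<circ> t) ` B \<subseteq> B'" by (intro bexI[of _ B2]) auto
  qed
qed

section \<open>Tangent subspaces are dynamically invariant\<close>

text \<open>
  The Gronwall estimate \<open>\<bar>y'\<bar> \<le> K \<bar>y\<bar>\<close>, integrated in both time directions:
  \<open>e\<^sup>-\<^sup>2\<^sup>K\<^sup>t \<bar>y\<bar>\<^sup>2\<close> is nonincreasing, so a zero of \<open>y\<close> propagates forwards, and
  \<open>e\<^sup>2\<^sup>K\<^sup>t \<bar>y\<bar>\<^sup>2\<close> is nondecreasing, so it propagates backwards.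
\<close>

lemma zero_propagates:
  fixes y :: "real \<Rightarrow> 'a::real_inner"
  assumes der: "\<And>s. s \<in> {a..b} \<Longrightarrow> (y has_vector_derivative y' s) (at s within {a..b})"
    and bound: "\<And>s. s \<in> {a..b} \<Longrightarrow> norm (y' s) \<le> K * norm (y s)"
    and "a \<le> b"
  shows "y a = 0 \<longleftrightarrow> y b = 0"
proof -
  let ?u = "\<lambda>c s. exp (c * s) * (y s \<bullet> y s)"
  let ?u' = "\<lambda>c s. exp (c * s) * (c * (y s \<bullet> y s) + 2 * (y s \<bullet> y' s))"
  have cont: "continuous_on {a..b} (?u c)" for c
  proof -
    have "continuous_on {a..b} y"
      using der by (meson continuous_on_eq_continuous_within has_vector_derivative_continuous)
    then show ?thesis by (intro continuous_intros)
  qed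
  have deru: "(?u c has_real_derivative ?u' c s) (at s)" if "a < s" "s < b" for c s
  proof -
    have "(y has_derivative (\<lambda>h. h *\<^sub>R y' s)) (at s)"
      using der[of s] that by (simp add: has_vector_derivative_def at_within_Icc_at)
    from has_derivative_inner[OF this this]
    have "((\<lambda>s. y s \<bullet> y s) has_real_derivative 2 * (y s \<bullet> y' s)) (at s)"
      by (rule has_derivative_imp_has_field_derivative) (simp add: inner_commute)
    then show ?thesis
      by (auto intro!: derivative_eq_intros simp: algebra_simps)
  qed
  have est: "\<bar>y s \<bullet> y' s\<bar> \<le> K * (y s \<bullet> y s)" if "a < s" "s < b" for s
  proof -
    have "\<bar>y s \<bullet> y' s\<bar> \<le> norm (y s) * norm (y' s)" by (rule Cauchy_Schwarz_ineq2)
    also have "\<dots> \<le> norm (y s) * (K * norm (y s))"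
      using bound[of s] that by (intro mult_left_mono) auto
    finally show ?thesis by (simp add: dot_square_norm power2_eq_square mult_ac)
  qed
  have "?u (- 2 * K) b \<le> ?u (- 2 * K) a"
  proof (rule DERIV_nonpos_imp_decreasing_open[OF \<open>a \<le> b\<close> _ cont])
    fix s assume "a < s" "s < b"
    moreover from est[OF this] have "?u' (- 2 * K) s \<le> 0"
      by (simp add: mult_le_0_iff abs_le_iff)
    ultimately show "\<exists>z. (?u (- 2 * K) has_real_derivative z) (at s) \<and> z \<le> 0"
      using deru by blast
  qed
  moreover have "?u (2 * K) a \<le> ?u (2 * K) b"
  proof (rule DERIV_nonneg_imp_increasing_open[OF \<open>a \<le> b\<close> _ cont])
    fix s assume "a < s" "s < b"
    moreover from est[OF this] have "?u' (2 * K) s \<ge> 0"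
      by (simp add: abs_le_iff)
    ultimately show "\<exists>z. (?u (2 * K) has_real_derivative z) (at s) \<and> 0 \<le> z"
      using deru by blast
  qed
  ultimately show ?thesis
    by (auto simp: mult_le_0_iff dot_square_norm)
qed

text \<open>
  A linear projection \<open>p\<close> onto \<open>S\<close> splits off the transverse component \<open>y = x - p x\<close> of a solution.
  Since \<open>\<gamma> (p x)\<close> lies in \<open>S\<close>, the velocity \<open>\<gamma> x - p (\<gamma> x)\<close> of \<open>y\<close> does not change when
  \<open>\<gamma> (p x)\<close> is subtracted from \<open>\<gamma> x\<close>, and so it is bounded by a multiple of
  \<open>\<bar>x - p x\<bar> = \<bar>y\<bar>\<close>.
\<close>

lemma dynamically_invariant_subspace:
  fixes \<gamma> :: "'a::euclidean_space \<Rightarrow> 'a"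
  assumes S: "subspace S" and tangent: "\<And>x. x \<in> S \<Longrightarrow> \<gamma> x \<in> S"
    and lip: "\<And>R. \<exists>L. L-lipschitz_on (cball 0 R) \<gamma>"
  shows "dynamically_invariant \<gamma> S"
  unfolding dynamically_invariant_def
proof (intro allI impI ballI)
  fix I x t0 t
  assume I: "is_interval I" and sol: "\<forall>t\<in>I. (x has_vector_derivative \<gamma> (x t)) (at t within I)"
    and t0: "t0 \<in> I" "x t0 \<in> S" and t: "t \<in> I"
  obtain p where p: "linear p" "range p \<subseteq> S" "\<And>v. v \<in> S \<Longrightarrow> p v = v"
    using linear_exists_left_inverse_on[OF linear_id S] by auto
  have mem_iff: "v \<in> S \<longleftrightarrow> v - p v = 0" for v
    using p by (metis eq_iff_diff_eq_0 rangeI subsetD)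
  define q where "q v = v - p v" for v
  have blq: "bounded_linear q" and blp: "bounded_linear p"
    unfolding q_def using p(1) by (auto intro: bounded_linear_sub bounded_linear_ident
        simp: linear_conv_bounded_linear)
  have qS: "q v = 0" if "v \<in> S" for v
    using that mem_iff q_def by simp
  define a where "a = min t0 t"
  define b where "b = max t0 t"
  have ab: "a \<le> b" "{a..b} \<subseteq> I"
    using mem_is_interval_1_I[OF I, of a b] t t0
    unfolding a_def b_def
    by (auto simp: min_def max_def intro: mem_is_interval_1_I[OF I] split: if_splits)
  have der: "(x has_vector_derivative \<gamma> (x s)) (at s within {a..b})" if "s \<in> {a..b}" for s
    using sol that ab has_vector_derivative_within_subset by blast
  have contx: "continuous_on {a..b} x"
    using der by (meson continuous_on_eq_continuous_within has_vector_derivative_continuous)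
  \<comment> \<open>The Lipschitz estimate needs a ball that contains both the solution and its projection to \<open>S\<close>.\<close>
  have "bounded (x ` {a..b} \<union> (p \<circ> x) ` {a..b})"
    using compact_continuous_image[OF contx] blp unfolding image_comp[symmetric]
    by (simp add: compact_imp_bounded bounded_linear_image)
  then obtain R where R: "x ` {a..b} \<union> (p \<circ> x) ` {a..b} \<subseteq> cball 0 R"
    by (auto simp: bounded_iff subset_iff)
  obtain L where L: "L-lipschitz_on (cball 0 R) \<gamma>" using lip by blast
  obtain M where M: "\<And>v. norm (q v) \<le> norm v * M" "M \<ge> 0"
    using bounded_linear.nonneg_bounded[OF blq] by blast
  have derq: "((\<lambda>s. q (x s)) has_vector_derivative q (\<gamma> (x s))) (at s within {a..b})"
    if "s \<in> {a..b}" for s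
    by (rule bounded_linear.has_vector_derivative[OF blq der[OF that]])
  have "norm (q (\<gamma> (x s))) \<le> (L * M) * norm (q (x s))" if "s \<in> {a..b}" for s
  proof -
    have "q (\<gamma> (p (x s))) = 0" using p by (intro qS tangent) auto
    then have "q (\<gamma> (x s)) = q (\<gamma> (x s) - \<gamma> (p (x s)))"
      by (simp add: linear_diff bounded_linear.linear[OF blq])
    also have "norm \<dots> \<le> norm (\<gamma> (x s) - \<gamma> (p (x s))) * M" by (rule M)
    also have "\<dots> \<le> (L * norm (x s - p (x s))) * M"
      using lipschitz_onD[OF L, of "x s" "p (x s)"] R that \<open>M \<ge> 0\<close>
      by (intro mult_right_mono) (auto simp: dist_norm image_subset_iff)
    finally show ?thesis by (simp add: q_def mult_ac)
  qed
  from zero_propagates[OF derq this ab(1)] have "q (x a) = 0 \<longleftrightarrow> q (x b) = 0" by blast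
  then have "x t0 \<in> S \<longleftrightarrow> x t \<in> S"
    by (auto simp: a_def b_def min_def max_def mem_iff q_def split: if_splits)
  then show "x t \<in> S" using t0 by simp
qed

lemma C1_imp_lipschitz_on_compact_convex:
  fixes f :: "'a::euclidean_space \<Rightarrow> 'b::real_normed_vector"
  assumes "C_k_on 1 UNIV f" "compact K" "convex K"
  shows "\<exists>L. L-lipschitz_on K f"
proof -
  have diff: "\<And>x. (f has_derivative frechet_derivative f (at x)) (at x)"
    and cont: "\<And>v. continuous_on UNIV (\<lambda>x. frechet_derivative f (at x) v)"
    using assms(1) by (auto simp: frechet_derivative_works)
  have "continuous_on K (\<lambda>x. \<Sum>v\<in>Basis. norm (frechet_derivative f (at x) v))"
    using cont by (intro continuous_intros) (blast intro: continuous_on_subset)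
  then have "bounded ((\<lambda>x. \<Sum>v\<in>Basis. norm (frechet_derivative f (at x) v)) ` K)"
    using assms(2) by (intro compact_imp_bounded compact_continuous_image)
  then obtain L where L: "L > 0"
    "\<And>x. x \<in> K \<Longrightarrow> (\<Sum>v\<in>Basis. norm (frechet_derivative f (at x) v)) \<le> L"
    unfolding bounded_pos by (auto simp: abs_le_iff)
  have "onorm (frechet_derivative f (at x)) \<le> L" if "x \<in> K" for x
    using L(2)[OF that] has_derivative_bounded_linear[OF diff]
    by (intro onorm_componentwise_le)
  then have "norm (f x - f y) \<le> L * norm (x - y)" if "x \<in> K" "y \<in> K" for x y
    using that has_derivative_at_withinI[OF diff] assms(3) by (intro differentiable_bound) auto
  then have "L-lipschitz_on K f"
    using \<open>L > 0\<close> by (intro lipschitz_onI) (auto simp: dist_norm)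
  then show ?thesis ..
qed

lemma network_vf_lipschitz_on_cball:
  fixes f :: "'v::euclidean_space ^ 'n::finite \<Rightarrow> 'v" and \<sigma> :: "'n \<Rightarrow> 'c::finite \<Rightarrow> 'c"
  assumes "C_k_on 1 UNIV f"
  shows "\<exists>L. L-lipschitz_on (cball 0 R) (network_vf \<sigma> f)"
proof -
  define h where "h i x = (\<chi> j. x $ \<sigma> j i)" for i and x :: "'v ^ 'c"
  let ?m = "real CARD('n)"
  have h: "norm (h i x) \<le> ?m * norm x" for i x
  proof -
    have "norm (h i x) \<le> (\<Sum>j\<in>UNIV. norm (h i x $ j))"
      by (simp add: norm_vec_def L2_set_le_sum)
    also have "\<dots> \<le> (\<Sum>j\<in>(UNIV::'n set). norm x)"
      unfolding h_def by (intro sum_mono) (simp add: Finite_Cartesian_Product.norm_nth_le)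
    finally show ?thesis by simp
  qed
  have hdiff: "h i x - h i y = h i (x - y)" for i x y
    by (simp add: h_def vec_eq_iff)
  obtain L where L: "L-lipschitz_on (cball 0 (?m * R)) f"
    using C1_imp_lipschitz_on_compact_convex[OF assms] by (meson compact_cball convex_cball)
  have L0: "0 \<le> L" by (rule lipschitz_on_nonneg[OF L])
  have hball: "h i x \<in> cball 0 (?m * R)" if "x \<in> cball 0 R" for i x
    using that order_trans[OF h[of i x] mult_left_mono[of "norm x" R ?m]] by simp
  have "norm (network_vf \<sigma> f x - network_vf \<sigma> f y) \<le> real CARD('c) * (L * ?m) * norm (x - y)"
    if xy: "x \<in> cball 0 R" "y \<in> cball 0 R" for x y
  proof -
    have "norm (network_vf \<sigma> f x - network_vf \<sigma> f y)
        \<le> (\<Sum>i\<in>UNIV. norm ((network_vf \<sigma> f x - network_vf \<sigma> f y) $ i))"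
      by (simp add: norm_vec_def L2_set_le_sum)
    also have "\<dots> = (\<Sum>i\<in>UNIV. norm (f (h i x) - f (h i y)))"
      by (simp add: network_vf_def h_def)
    also have "\<dots> \<le> (\<Sum>i\<in>(UNIV::'c set). L * (?m * norm (x - y)))"
    proof (intro sum_mono)
      fix i
      have "norm (f (h i x) - f (h i y)) \<le> L * norm (h i x - h i y)"
        using lipschitz_onD[OF L hball hball] xy by (simp add: dist_norm)
      also have "\<dots> \<le> L * (?m * norm (x - y))"
        unfolding hdiff using h L0 by (intro mult_left_mono)
      finally show "norm (f (h i x) - f (h i y)) \<le> L * (?m * norm (x - y))" .
    qed
    finally show ?thesis by (simp add: mult_ac)
  qed
  then have "(real CARD('c) * (L * ?m))-lipschitz_on (cball 0 R) (network_vf \<sigma> f)"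
    using L0 by (intro lipschitz_onI) (auto simp: dist_norm)
  then show ?thesis ..
qed

section \<open>The linear system of a single map\<close>

lemma smooth_on_bounded_linear:
  assumes "bounded_linear f"
  shows "smooth_on UNIV f"
proof -
  have const: "C_k_on k UNIV (\<lambda>x::'a. c::'b)" for k c
    by (induction k arbitrary: c) (simp_all add: frechet_derivative_const)
  have fd: "frechet_derivative f (at x) = f" for x
    using frechet_derivative_at[OF bounded_linear_imp_has_derivative[OF assms]] by simp
  have "C_k_on k UNIV f" for k
  proof (cases k)
    case 0
    then show ?thesis using assms by (simp add: linear_continuous_on)
  next
    case (Suc k)
    then show ?thesis
      using assms const by (simp add: fd bounded_linear_imp_differentiable)
  qed
  then show ?thesis by (simp add: smooth_on_def)
qed

text \<open>
  The series is the \<open>i\<close>-th component of \<open>e\<^sup>t\<^sup>A a\<close> for the matrix \<open>A\<close> of the linear map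
  \<open>a \<mapsto> a \<circ> s\<close>; termwise differentiation replaces \<open>a (s\<^sup>n i)\<close> by \<open>a (s\<^sup>n (s i))\<close>.
\<close>

lemma linear_flow_of_map:
  fixes s :: "'c::finite \<Rightarrow> 'c" and a :: "'c \<Rightarrow> real"
  obtains F where "\<And>i. F i 0 = a i"
    and "\<And>i t. (F i has_real_derivative F (s i) t) (at t)"
proof
  define c where "c i n = a ((s ^^ n) i) / fact n" for i and n :: nat
  define F where "F i t = (\<Sum>n. c i n * t ^ n)" for i and t :: real
  obtain M where M: "\<And>i. \<bar>a i\<bar> \<le> M"
    using finite_imageI[of UNIV "\<lambda>i. \<bar>a i\<bar>"] by (metis Max_ge UNIV_I finite imageI)
  have summ: "summable (\<lambda>n. c i n * t ^ n)" for i t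
  proof (rule summable_comparison_test')
    show "summable (\<lambda>n. M * (inverse (fact n) * \<bar>t\<bar> ^ n))"
      by (intro summable_mult summable_exp)
    show "norm (c i n * t ^ n) \<le> M * (inverse (fact n) * \<bar>t\<bar> ^ n)" for n
      using mult_right_mono[OF M[of "(s ^^ n) i"], of "\<bar>t\<bar> ^ n / fact n"]
      by (simp add: c_def abs_mult power_abs divide_simps)
  qed
  show "F i 0 = a i" for i
    unfolding F_def using powser_zero[of "c i"] by (simp add: c_def)
  have "diffs (c i) = c (s i)" for i
    by (simp add: fun_eq_iff diffs_def c_def funpow_swap1 divide_simps)
  then show "(F i has_real_derivative F (s i) t) (at t)" for i t
    unfolding F_def using termdiffs_strong_converges_everywhere[of "c i" t] summ by simp
qed

section \<open>Synchrony spaces and balanced partitions\<close>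

lemma subspace_Syn: "subspace (Syn P :: ('v::real_vector ^ 'c::finite) set)"
proof (rule subspaceI)
  show "0 \<in> (Syn P :: ('v ^ 'c) set)" by (simp add: Syn_def)
next
  fix x y :: "'v ^ 'c" assume "x \<in> Syn P" "y \<in> Syn P"
  then show "x + y \<in> Syn P"
    unfolding Syn_def mem_Collect_eq vector_add_component by metis
next
  fix c and x :: "'v ^ 'c" assume "x \<in> Syn P"
  then show "c *\<^sub>R x \<in> Syn P"
    unfolding Syn_def mem_Collect_eq vector_scaleR_component by metis
qed

lemma network_vf_in_Syn:
  assumes "balanced \<sigma> P" "x \<in> Syn P"
  shows "network_vf \<sigma> f x \<in> Syn P"
proof -
  have sync: "x $ \<sigma> j i = x $ \<sigma> j k" if "B \<in> P" "i \<in> B" "k \<in> B" for j B i k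
  proof -
    from assms(1) \<open>B \<in> P\<close> obtain B' where "B' \<in> P" "\<sigma> j ` B \<subseteq> B'"
      unfolding balanced_def by blast
    then show ?thesis using that assms(2) unfolding Syn_def by blast
  qed
  have inputs: "(\<chi> j. x $ \<sigma> j i) = (\<chi> j. x $ \<sigma> j k)" if "B \<in> P" "i \<in> B" "k \<in> B" for B i k
    unfolding vec_eq_iff vec_lambda_beta by (intro allI sync[OF that])
  show ?thesis
    unfolding Syn_def network_vf_def mem_Collect_eq vec_lambda_beta
    by (intro ballI arg_cong[of _ _ f] inputs)
qed

text \<open>
  For the converse it suffices to test the linear response functions \<open>X \<mapsto> X\<^sub>j\<close>: the initial condition
  is supported on the block \<open>B'\<close> that contains \<open>\<sigma> j i\<close> for one chosen cell \<open>i\<close>, and synchrony of the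
  velocities at time \<open>0\<close> says that \<open>\<sigma> j\<close> sends the whole block of \<open>i\<close> into \<open>B'\<close>.
\<close>

lemma balanced_if_dynamically_invariant:
  fixes \<sigma> :: "'i::finite \<Rightarrow> 'c::finite \<Rightarrow> 'c"
  assumes P: "partition_on UNIV P"
    and inv: "\<And>j. dynamically_invariant (network_vf \<sigma> (\<lambda>X :: 'v::euclidean_space ^ 'i. X $ j)) (Syn P)"
  shows "balanced \<sigma> P"
  unfolding balanced_def
proof (intro ballI)
  fix s B assume "s \<in> range \<sigma>" and B: "B \<in> P"
  then obtain j where s: "s = \<sigma> j" by blast
  obtain i where i: "i \<in> B" using B P by (metis all_not_in_conv partition_onD3)
  obtain B' where B': "B' \<in> P" "s i \<in> B'" using P partition_onD1 by blast
  obtain F where F0: "\<And>k. F k 0 = indicator B' k"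
    and F': "\<And>k t. (F k has_real_derivative F (s k) t) (at t)"
    using linear_flow_of_map[of "indicator B'" s] by blast
  obtain e :: 'v where e: "e \<noteq> 0" using nonzero_Basis nonempty_Basis by blast
  define x where "x t = (\<chi> k. F k t *\<^sub>R e)" for t
  have "(x has_vector_derivative network_vf \<sigma> (\<lambda>X. X $ j) (x t)) (at t)" for t
  proof -
    \<comment> \<open>As a sum over the cells, the solution can be differentiated termwise.\<close>
    have vec: "(\<chi> k. u k *\<^sub>R e) = (\<Sum>k\<in>UNIV. u k *\<^sub>R axis k e)" for u :: "'c \<Rightarrow> real"
      by (simp add: vec_eq_iff axis_def if_distrib[of "\<lambda>z. _ *\<^sub>R z"] cong: if_cong)
    have "((\<lambda>t. \<Sum>k\<in>UNIV. F k t *\<^sub>R axis k e) has_vector_derivative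
        (\<Sum>k\<in>UNIV. F (s k) t *\<^sub>R axis k e)) (at t)"
      using has_vector_derivative_scaleR[OF F' has_vector_derivative_const]
      by (intro has_vector_derivative_sum) simp
    then show ?thesis
      by (simp add: x_def[abs_def] network_vf_def s flip: vec)
  qed
  moreover have "x 0 \<in> Syn P"
  proof -
    have ind: "(indicator B' k :: real) = indicator B' l" if "C \<in> P" "k \<in> C" "l \<in> C" for C k l
    proof -
      have "C = B' \<or> C \<inter> B' = {}"
        using that(1) B'(1) partition_onD2[OF P] disjointD by blast
      then show ?thesis using that by (auto simp: indicator_def)
    qed
    show ?thesis
      unfolding Syn_def x_def F0 mem_Collect_eq vec_lambda_beta
      by (intro ballI arg_cong[of _ _ "\<lambda>c. c *\<^sub>R e"] ind)
  qed
  ultimately have x: "x t \<in> Syn P" for t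
    using inv[of j, unfolded dynamically_invariant_def, rule_format, of UNIV x 0 t] by simp
  have "s k \<in> B'" if "k \<in> B" for k
  proof -
    have "x t $ i = x t $ k" for t
      using x[of t] that i B unfolding Syn_def by blast
    then have "F i = F k"
      using e by (simp add: x_def fun_eq_iff)
    then have "F (s i) 0 = F (s k) 0"
      using DERIV_unique[OF F'[of i 0], of "F (s k) 0"] F'[of k 0] by simp
    then show ?thesis using B'(2) by (auto simp: F0 indicator_def split: if_splits)
  qed
  then show "\<exists>B'\<in>P. s ` B \<subseteq> B'" using B' by blast
qed

lemma dynamically_invariant_iff_balanced:
  fixes \<sigma> :: "'i::finite \<Rightarrow> 'c::finite \<Rightarrow> 'c"
  assumes "partition_on UNIV P"
  shows "(\<forall>g :: 'v::euclidean_space ^ 'i \<Rightarrow> 'v. smooth_on UNIV g \<longrightarrow>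
    dynamically_invariant (network_vf \<sigma> g) (Syn P)) \<longleftrightarrow> balanced \<sigma> P"
proof (intro iffI allI impI)
  assume inv: "\<forall>g :: 'v ^ 'i \<Rightarrow> 'v. smooth_on UNIV g \<longrightarrow>
    dynamically_invariant (network_vf \<sigma> g) (Syn P)"
  show "balanced \<sigma> P"
    by (rule balanced_if_dynamically_invariant[OF assms, where 'v = 'v],
        rule inv[rule_format], rule smooth_on_bounded_linear, rule bounded_linear_vec_nth)
next
  fix g :: "'v ^ 'i \<Rightarrow> 'v"
  assume bal: "balanced \<sigma> P" and "smooth_on UNIV g"
  then have C1: "C_k_on 1 UNIV g" unfolding smooth_on_def by blast
  show "dynamically_invariant (network_vf \<sigma> g) (Syn P)"
    by (rule dynamically_invariant_subspace[OF subspace_Syn network_vf_in_Syn[OF bal]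
        network_vf_lipschitz_on_cball[OF C1]])
qed

lemma synchrony_spaces_eq_balanced:
  "(synchrony_spaces \<sigma> :: ('v::euclidean_space ^ 'c::finite) set set) =
    {Syn P | P. partition_on UNIV P \<and> balanced \<sigma> P}"
  unfolding synchrony_spaces_def
  by (intro Collect_cong iff_exI conj_cong refl dynamically_invariant_iff_balanced)

section \<open>Symmetries and synchrony of the normal form\<close>

theorem corollary7p4:
  fixes \<sigma> :: "'n::finite \<Rightarrow> 'c::finite \<Rightarrow> 'c"
    and \<sigma>' :: "'m::finite \<Rightarrow> 'c \<Rightarrow> 'c"
    and f :: "'v::euclidean_space ^ 'n \<Rightarrow> 'v"
    and fbar :: "'v ^ 'm \<Rightarrow> 'v"
    and N :: "nat \<Rightarrow> ('v ^ 'm \<Rightarrow> 'v) set"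
    and r :: nat
  assumes "inj \<sigma>"
    and "inj \<sigma>'"
    and "range \<sigma>' = generated_semigroup (range \<sigma>)"
    and "smooth_on UNIV f"
    and "f 0 = 0"
    and "r \<ge> 1"
    and "normal_form_spaces \<sigma>' (extend_response \<sigma> \<sigma>' f) r N"
    and "local_normal_form \<sigma>' (extend_response \<sigma> \<sigma>' f) r N fbar"
  shows "network_symmetries \<sigma>' = network_symmetries \<sigma> \<and>
    (synchrony_spaces \<sigma>' :: ('v ^ 'c) set set) = synchrony_spaces \<sigma>"
proof
  show "network_symmetries \<sigma>' = network_symmetries \<sigma>"
    by (rule network_symmetries_generated_semigroup[OF assms(3)])
  show "(synchrony_spaces \<sigma>' :: ('v ^ 'c) set set) = synchrony_spaces \<sigma>"
    unfolding synchrony_spaces_eq_balanced balanced_generated_semigroup[OF assms(3)] ..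
qed

end
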